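(* Let $q$ be a prime power, $1\le k\le n$, and let $W$ be the $k\times n$ matrix $(Z_{i,j})_{i\in[k],j\in[n]}$ over $\mathbb{F}=\mathbb{F}_q(Z_{1,1},\dots,Z_{k,n})$. Let $V_1,\dots,V_\ell$ be $\mathbb{F}_q$-subspaces of $\mathbb{F}_q^n$, each of dimension at most $k$. Then \[ \dim_{\mathbb{F}}\Big(\bigcap_{i\in[\ell]}W_{V_i}\Big)=\max_{P_1\sqcup\cdots\sqcup P_s=[\ell]}\Big(\sum_{i\in[s]}\dim_{\mathbb{F}_q}\Big(\bigcap_{j\in P_i}V_j\Big)-(s-1)k\Big), \] where the maximum is over all partitions of $[\ell]$ into nonempty parts $P_1,\dots,P_s$ ($s\ge1$).
   Context: $Z_{i,j}$ are independent indeterminates. For an $\mathbb{F}_q$-subspace $V\subseteq\mathbb{F}_q^n$, $W_V\subseteq\mathbb{F}^k$ denotes the $\mathbb{F}$-span of the columns of $WA$, where $A\in\mathbb{F}_q^{n\times\dim V}$ is any matrix whose $\mathbb{F}_q$-column span is $V$. *)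

theory Defs
  imports "HOL-Analysis.Analysis" "HOL-Library.Poly_Mapping"
    "HOL-Library.Disjoint_Sets" "HOL-Computational_Algebra.Fraction_Field"
begin

text \<open>Multivariate polynomials over 'a in the indeterminates Z_(i,j), i :: 'k, j :: 'n,
  represented as finitely supported maps from monomials (exponent arrays, curried) to coefficients.\<close>
type_synonym ('a, 'k, 'n) mpoly = "('k \<Rightarrow>\<^sub>0 'n \<Rightarrow>\<^sub>0 nat) \<Rightarrow>\<^sub>0 'a"

type_synonym ('a, 'k, 'n) ratfun = "('a, 'k, 'n) mpoly fract"

definition const_rf :: "'a::field \<Rightarrow> ('a, 'k::linorder, 'n::linorder) ratfun" where
  "const_rf c = Fract (Poly_Mapping.single 0 c) 1"

definition Zvar :: "'k::linorder \<Rightarrow> 'n::linorder \<Rightarrow> ('a::field, 'k, 'n) ratfun" where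
  "Zvar i j = Fract (Poly_Mapping.single (Poly_Mapping.single i (Poly_Mapping.single j 1)) 1) 1"

definition Wmat :: "('a::field, 'k, 'n) ratfun ^ ('n::{finite,linorder}) ^ ('k::{finite,linorder})" where
  "Wmat = (\<chi> i j. Zvar i j)"

definition embed_vec :: "('a::field, 'n::{finite,linorder}) vec \<Rightarrow> (('a, 'k::{finite,linorder}, 'n) ratfun, 'n) vec" where
  "embed_vec v = (\<chi> j. const_rf (v $ j))"

text \<open>W_V: the F-span of the columns of W A, where the F_q-column span of A is V;
  equivalently the F-span of W v for v \<in> V.\<close>
definition W_sub :: "('a::field, 'n::{finite,linorder}) vec set \<Rightarrow> (('a, 'k::{finite,linorder}, 'n) ratfun, 'k) vec set" where
  "W_sub V = vec.span ((\<lambda>v. Wmat *v embed_vec v) ` V)"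

end

theory Submission
  imports Defs "HOL-Computational_Algebra.Polynomial_Factorial"
begin

text \<open>
  For a part \<open>J\<close> write \<open>V\<^bsub>J\<^esub>\<close> for the intersection of its members. The lower bound is subadditivity of
  codimension, since the intersection of the \<open>W\<close>-images of the \<open>V\<^sub>j\<close>, \<open>j \<in> J\<close>, contains that of \<open>V\<^bsub>J\<^esub>\<close>.

  For the upper bound, \<open>g J = k - dim V\<^bsub>J\<^esub>\<close> is intersecting submodular, so a maximal \<open>c \<ge> 0\<close> with
  \<open>c(J) \<le> g J\<close> has tight sets that partition all indices (Dilworth truncation), and it suffices to find
  \<open>\<Sum> c\<^sub>i\<close> independent functionals on the intersection. Label \<open>c\<^sub>i\<close> of the \<open>k\<close> rows by \<open>i\<close> and specialise
  \<open>W\<close> to a matrix \<open>M\<close> whose rows labelled \<open>i\<close> are generic subject to vanishing on \<open>V\<^sub>i\<close>. The inequalities for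
  \<open>c\<close> are the conditions under which Rado's theorem makes \<open>M\<close> injective on every \<open>V\<^sub>i\<close>. Then for a row
  \<open>r\<close> labelled \<open>i\<close> some minors of \<open>W\<close> give a functional that kills the image of \<open>V\<^sub>i\<close> and specialises to a
  nonzero multiple of the \<open>r\<close>-th coordinate; so these functionals are independent before
  specialisation as well.
\<close>

section \<open>Ring homomorphisms and determinants\<close>

locale unital_ring_hom =
  fixes \<phi> :: "'a::comm_ring_1 \<Rightarrow> 'b::comm_ring_1"
  assumes add: "\<phi> (x + y) = \<phi> x + \<phi> y"
    and mult: "\<phi> (x * y) = \<phi> x * \<phi> y"
    and one: "\<phi> 1 = 1"
begin

lemma zero: "\<phi> 0 = 0"
  using add[of 0 0] by simp

lemma uminus: "\<phi> (- x) = - \<phi> x"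
  using add[of x "- x"] zero by (simp add: eq_neg_iff_add_eq_0 add.commute)

lemma sum: "\<phi> (sum f A) = (\<Sum>x\<in>A. \<phi> (f x))"
  by (induction A rule: infinite_finite_induct) (auto simp: zero add)

lemma prod: "\<phi> (prod f A) = (\<Prod>x\<in>A. \<phi> (f x))"
  by (induction A rule: infinite_finite_induct) (auto simp: one mult)

lemma of_int_sign: "\<phi> (of_int (sign p)) = of_int (sign p)"
  by (simp add: sign_def one uminus)

definition mapv :: "'a ^ 'n \<Rightarrow> 'b ^ 'n"
  where "mapv v = (\<chi> i. \<phi> (v $ i))"

lemma mapv_nth [simp]: "mapv v $ i = \<phi> (v $ i)"
  by (simp add: mapv_def)

lemma mapv_axis [simp]: "mapv (axis i 1) = axis i 1"
  by (simp add: vec_eq_iff axis_def zero one)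

lemma hom_det: "\<phi> (det A) = det (\<chi> i. mapv (A $ i))"
  by (simp add: det_def sum prod mult of_int_sign)

end

text \<open>Exchange with unit vectors completes the family to a basis, whose members become the
  rows of a nonsingular matrix. Recording each row as an index (\<open>Inl\<close>) or a unit vector
  (\<open>Inr\<close>), not as a vector, lets the same matrix be written down over another
  ring.\<close>

lemma independent_family_extend_det:
  fixes b :: "'i \<Rightarrow> 'a::field ^ 'k"
  assumes "inj_on b I" "vec.independent (b ` I)"
  obtains f :: "'k \<Rightarrow> 'i + 'k" where "\<And>i. i \<in> I \<longleftrightarrow> (\<exists>s. f s = Inl i)"
    "det (\<chi> s. case f s of Inl i \<Rightarrow> b i | Inr t \<Rightarrow> axis t 1) \<noteq> 0"
proof -
  let ?S = "b ` I \<union> cart_basis"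
  have "b ` I \<subseteq> ?S" by simp
  then obtain C where C: "b ` I \<subseteq> C" "C \<subseteq> ?S" "vec.independent C" "?S \<subseteq> vec.span C"
    using vec.maximal_independent_subset_extend[OF _ assms(2)] by blast
  have "vec.span ?S = UNIV"
    by (metis span_cart_basis vec.span_mono Un_upper2 top.extremum_unique)
  with C(4) have span: "vec.span C = UNIV"
    by (metis vec.span_mono vec.span_span top.extremum_unique)
  have finC: "finite C" using C(3) by (rule vec.finiteI_independent)
  have "card C = CARD('k)"
    using span by (metis vec_dim_card vec.dim_span_eq_card_independent C(3))
  then obtain h :: "'k \<Rightarrow> 'a ^ 'k" where h: "bij_betw h UNIV C"
    using finite_same_card_bij[OF finite_class.finite_UNIV finC] by auto
  define f where "f s = (if h s \<in> b ` I then Inl (the_inv_into I b (h s)) else Inr (SOME t. h s = axis t 1))" for s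
  have f: "(case f s of Inl i \<Rightarrow> b i | Inr t \<Rightarrow> axis t 1) = h s" for s
  proof (cases "h s \<in> b ` I")
    case True
    then show ?thesis using f_the_inv_into_f[OF assms(1)] by (simp add: f_def)
  next
    case False
    with h C(2) have "h s \<in> cart_basis" by (metis Un_iff bij_betwE iso_tuple_UNIV_I subsetD)
    then have "\<exists>t. h s = axis t 1" by (auto simp: cart_basis_def)
    from someI_ex[OF this] False show ?thesis by (simp add: f_def)
  qed
  have hit: "\<exists>s. f s = Inl i" if "i \<in> I" for i
  proof -
    have "b i \<in> C" using that C(1) by blast
    then obtain s where "h s = b i" using h by (metis bij_betw_iff_bijections)
    then have "f s = Inl i" using that the_inv_into_f_f[OF assms(1)] by (simp add: f_def)
    then show ?thesis ..
  qed
  moreover have "i \<in> I" if "f s = Inl i" for s i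
    using that the_inv_into_into[OF assms(1) _ subset_refl] by (auto simp: f_def split: if_splits)
  ultimately have iff: "i \<in> I \<longleftrightarrow> (\<exists>s. f s = Inl i)" for i by blast
  have "rows (\<chi> s. h s) = C"
    using h by (auto simp: rows_def row_def bij_betw_def image_def)
  then have "\<exists>B. (\<chi> s. h s) ** B = mat 1 \<and> True"
    using span matrix_left_invertible_span_rows_gen[of "\<chi> s. h s"] matrix_left_right_inverse by metis
  then have "invertible (\<chi> s. h s)"
    using invertible_right_inverse by blast
  then have "det (\<chi> s. h s) \<noteq> 0"
    using invertible_det_nz by blast
  with iff f show thesis by (intro that[of f]) auto
qed

lemma det_nz_rows_independent:
  fixes A :: "'a::field ^ 'n ^ 'n"
  assumes "det A \<noteq> 0"
  shows "inj (\<lambda>s. A $ s)" "vec.independent (range (\<lambda>s. A $ s))"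
proof -
  show "inj (\<lambda>s. A $ s)"
    using assms by (intro injI) (metis det_identical_rows row_def vec_nth_inverse)
  have "rows A = range (\<lambda>s. A $ s)"
    by (auto simp: rows_def row_def)
  then show "vec.independent (range (\<lambda>s. A $ s))"
    using assms det_dependent_rows by metis
qed

text \<open>Independence is witnessed by a determinant. The determinant formed over the ring has
  nonzero image under \<phi>, hence is nonzero itself, and the injective \<iota> keeps it
  nonzero.\<close>

lemma independent_family_lift:
  fixes \<phi> :: "'r::comm_ring_1 \<Rightarrow> 'a::field" and \<iota> :: "'r \<Rightarrow> 'b::field" and p :: "'i \<Rightarrow> 'r ^ 'k"
  assumes "unital_ring_hom \<phi>" "unital_ring_hom \<iota>" "inj \<iota>"
    and "inj_on (\<lambda>i. unital_ring_hom.mapv \<phi> (p i)) I" "vec.independent ((\<lambda>i. unital_ring_hom.mapv \<phi> (p i)) ` I)"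
  shows "inj_on (\<lambda>i. unital_ring_hom.mapv \<iota> (p i)) I" "vec.independent ((\<lambda>i. unital_ring_hom.mapv \<iota> (p i)) ` I)"
proof -
  interpret \<phi>: unital_ring_hom \<phi> by fact
  interpret \<iota>: unital_ring_hom \<iota> by fact
  obtain f :: "'k \<Rightarrow> 'i + 'k" where f: "\<And>i. i \<in> I \<longleftrightarrow> (\<exists>s. f s = Inl i)"
    "det (\<chi> s. case f s of Inl i \<Rightarrow> \<phi>.mapv (p i) | Inr t \<Rightarrow> axis t 1) \<noteq> 0"
    using independent_family_extend_det[OF assms(4,5)] by blast
  define X where "X = (\<chi> s. case f s of Inl i \<Rightarrow> p i | Inr t \<Rightarrow> axis t 1)"
  have "(\<chi> s. \<phi>.mapv (X $ s)) = (\<chi> s. case f s of Inl i \<Rightarrow> \<phi>.mapv (p i) | Inr t \<Rightarrow> axis t 1)"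
    unfolding X_def by (intro Cart_lambda_cong) (simp split: sum.split)
  then have "det X \<noteq> 0" using f(2) \<phi>.hom_det[of X] \<phi>.zero by metis
  then have "det (\<chi> s. \<iota>.mapv (X $ s)) \<noteq> 0"
    using \<iota>.hom_det[of X] \<iota>.zero assms(3) by (metis injD)
  note nz = det_nz_rows_independent[OF this]
  obtain g where g: "f (g i) = Inl i" if "i \<in> I" for i using f(1) by metis
  have eq: "\<iota>.mapv (p i) = (\<chi> s. \<iota>.mapv (X $ s)) $ g i" if "i \<in> I" for i
    using g[OF that] by (simp add: X_def)
  have "inj_on g I" using g by (metis inj_onI sum.inject(1))
  then show "inj_on (\<lambda>i. \<iota>.mapv (p i)) I"
    using nz(1) eq by (smt (verit) inj_onD inj_onI injD)
  show "vec.independent ((\<lambda>i. \<iota>.mapv (p i)) ` I)"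
    using nz(2) by (rule vec.independent_mono) (use eq in auto)
qed

lemma unital_ring_hom_to_fract: "unital_ring_hom to_fract"
  by unfold_locales (simp_all add: to_fract_def One_fract_def)

section \<open>Evaluation of polynomials\<close>

definition monomial_value :: "('k::finite \<Rightarrow> 'n::finite \<Rightarrow> 'b::comm_ring_1) \<Rightarrow> ('k \<Rightarrow>\<^sub>0 'n \<Rightarrow>\<^sub>0 nat) \<Rightarrow> 'b" where
  "monomial_value z m = (\<Prod>i\<in>UNIV. \<Prod>j\<in>UNIV. z i j ^ Poly_Mapping.lookup (Poly_Mapping.lookup m i) j)"

definition eval_mpoly :: "('a::comm_ring_1 \<Rightarrow> 'b::comm_ring_1) \<Rightarrow> ('k::finite \<Rightarrow> 'n::finite \<Rightarrow> 'b) \<Rightarrow> ('a, 'k, 'n) mpoly \<Rightarrow> 'b" where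
  "eval_mpoly g z p = (\<Sum>m\<in>Poly_Mapping.keys p. g (Poly_Mapping.lookup p m) * monomial_value z m)"

lemma monomial_value_0 [simp]: "monomial_value z 0 = 1"
  by (simp add: monomial_value_def)

lemma monomial_value_add: "monomial_value z (m + m') = monomial_value z m * monomial_value z m'"
  by (simp add: monomial_value_def lookup_add power_add prod.distrib)

lemma monomial_value_var [simp]:
  "monomial_value z (Poly_Mapping.single i (Poly_Mapping.single j 1)) = z i j"
proof -
  have "z i' j' ^ Poly_Mapping.lookup (Poly_Mapping.lookup (Poly_Mapping.single i (Poly_Mapping.single j (1::nat))) i') j'
    = (if j = j' then if i = i' then z i j else 1 else 1)" for i' j'
    by (simp add: lookup_single when_def)
  then show ?thesis
    by (simp add: monomial_value_def prod.delta)
qed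

lemma mpoly_eq_sum_singles: "(\<Sum>m\<in>Poly_Mapping.keys p. Poly_Mapping.single m (Poly_Mapping.lookup p m)) = p"
  by (rule poly_mapping_eqI)
     (auto simp: lookup_sum lookup_single when_def sum.delta in_keys_iff)

context
  fixes g :: "'a::comm_ring_1 \<Rightarrow> 'b::comm_ring_1"
  assumes g: "unital_ring_hom g"
begin

interpretation g: unital_ring_hom g by (rule g)

lemma eval_mpoly_superset:
  assumes "finite S" "Poly_Mapping.keys p \<subseteq> S"
  shows "eval_mpoly g z p = (\<Sum>m\<in>S. g (Poly_Mapping.lookup p m) * monomial_value z m)"
  unfolding eval_mpoly_def
  by (rule sum.mono_neutral_left[OF assms]) (auto simp: in_keys_iff g.zero)

lemma eval_mpoly_add: "eval_mpoly g z (p + q) = eval_mpoly g z p + eval_mpoly g z q"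
proof -
  let ?S = "Poly_Mapping.keys p \<union> Poly_Mapping.keys q"
  have "eval_mpoly g z (p + q) = (\<Sum>m\<in>?S. g (Poly_Mapping.lookup (p + q) m) * monomial_value z m)"
    by (rule eval_mpoly_superset) (auto simp: keys_add)
  moreover have "eval_mpoly g z p = (\<Sum>m\<in>?S. g (Poly_Mapping.lookup p m) * monomial_value z m)"
    by (rule eval_mpoly_superset) auto
  moreover have "eval_mpoly g z q = (\<Sum>m\<in>?S. g (Poly_Mapping.lookup q m) * monomial_value z m)"
    by (rule eval_mpoly_superset) auto
  ultimately show ?thesis
    by (simp add: lookup_add g.add distrib_right sum.distrib)
qed

lemma eval_mpoly_single [simp]: "eval_mpoly g z (Poly_Mapping.single m c) = g c * monomial_value z m"
  by (auto simp: eval_mpoly_def g.zero)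

lemma eval_mpoly_sum: "eval_mpoly g z (sum f A) = (\<Sum>x\<in>A. eval_mpoly g z (f x))"
  by (induction A rule: infinite_finite_induct) (auto simp: eval_mpoly_add eval_mpoly_def[of g z 0])

lemma eval_mpoly_mult: "eval_mpoly g z (p * q) = eval_mpoly g z p * eval_mpoly g z q"
proof -
  let ?s = "\<lambda>p m. Poly_Mapping.single m (Poly_Mapping.lookup p m)"
  have "p * q = (\<Sum>m\<in>Poly_Mapping.keys p. ?s p m) * (\<Sum>m\<in>Poly_Mapping.keys q. ?s q m)"
    by (simp only: mpoly_eq_sum_singles)
  also have "\<dots> = (\<Sum>m\<in>Poly_Mapping.keys p. \<Sum>m'\<in>Poly_Mapping.keys q.
      Poly_Mapping.single (m + m') (Poly_Mapping.lookup p m * Poly_Mapping.lookup q m'))"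
    by (simp add: sum_product mult_single)
  finally show ?thesis
    by (simp add: eval_mpoly_sum g.mult monomial_value_add)
       (simp add: eval_mpoly_def sum_product algebra_simps)
qed

lemma unital_ring_hom_eval_mpoly: "unital_ring_hom (eval_mpoly g z)"
proof
  show "eval_mpoly g z 1 = 1"
    unfolding single_one[symmetric] eval_mpoly_single by (simp add: g.one)
qed (simp_all add: eval_mpoly_add eval_mpoly_mult)

end

section \<open>Supermodular and submodular set functions\<close>

text \<open>
  Rado's theorem, with \<open>h B\<close> in the role of the corank of \<open>B\<close>: if a set of the family has two elements,
  one of them can be removed without violating the condition.
\<close>
lemma supermodular_transversal:
  fixes h :: "'x set \<Rightarrow> nat" and A :: "'k::finite \<Rightarrow> 'x set"
  assumes h: "\<And>B B' C. C \<subseteq> B \<inter> B' \<Longrightarrow> h B + h B' \<le> h (B \<union> B') + h C"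
    and "\<And>r. finite (A r)"
    and "\<And>I. h (\<Union>r\<in>I. A r) + card I \<le> CARD('k)"
  shows "\<exists>A'. (\<forall>r. A' r \<subseteq> A r \<and> card (A' r) \<le> 1) \<and> h (\<Union>r. A' r) = 0"
  using assms(2,3)
proof (induction "\<Sum>r\<in>UNIV. card (A r)" arbitrary: A rule: less_induct)
  case less
  show ?case
  proof (cases "\<forall>r. card (A r) \<le> 1")
    case True
    \<comment> \<open>For \<open>I = UNIV\<close> the condition leaves no room for a positive value
      of \<open>h\<close>.\<close>
    then show ?thesis using less.prems(2)[of UNIV] by (intro exI[of _ A]) auto
  next
    case False
    then obtain r0 where r0: "card (A r0) > 1" by (metis not_le)
    then obtain x y where xy: "x \<in> A r0" "y \<in> A r0" "x \<noteq> y"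
      by (metis card_le_Suc0_iff_eq less.prems(1) not_less One_nat_def)
    let ?D = "\<lambda>x. A(r0 := A r0 - {x})"
    have step: ?thesis if x: "x \<in> A r0" and *: "\<And>I. h (\<Union>r\<in>I. ?D x r) + card I \<le> CARD('k)" for x
    proof -
      have sub: "?D x r \<subseteq> A r" for r by auto
      have fin: "finite (?D x r)" for r using less.prems(1) sub finite_subset by blast
      have "(\<Sum>r\<in>UNIV. card (?D x r)) < (\<Sum>r\<in>UNIV. card (A r))"
      proof (rule sum_strict_mono_ex1)
        show "\<forall>r\<in>UNIV. card (?D x r) \<le> card (A r)"
          using sub less.prems(1) card_mono by blast
        show "\<exists>r\<in>UNIV. card (?D x r) < card (A r)"
          using card_Diff1_less[OF less.prems(1) x] by (metis UNIV_I fun_upd_same)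
      qed simp
      from less.hyps[OF this fin *] obtain A' where
        "\<forall>r. A' r \<subseteq> ?D x r \<and> card (A' r) \<le> 1" "h (\<Union>r. A' r) = 0" by blast
      with sub show ?thesis by (meson subset_trans)
    qed
    show ?thesis
    proof (rule ccontr)
      assume no: "\<not> ?thesis"
      \<comment> \<open>If neither \<open>x\<close> nor \<open>y\<close> can be removed, both
        removals violate the condition, at \<open>I\<close> and at \<open>J\<close>, and both sets
        contain \<open>r0\<close>. Supermodularity compares them with \<open>I \<union> J\<close>
        and \<open>I \<inter> J - {r0}\<close>. Their cardinalities lose only one against
        \<open>card I + card J\<close>, while the two violations exceed the bound by at least two in
        total.\<close>
      from no step[OF xy(1)] obtain I where I: "h (\<Union>r\<in>I. ?D x r) + card I > CARD('k)" by (meson not_le)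
      from no step[OF xy(2)] obtain J where J: "h (\<Union>r\<in>J. ?D y r) + card J > CARD('k)" by (meson not_le)
      have r0_in: "r0 \<in> I" if "h (\<Union>r\<in>I. ?D x r) + card I > CARD('k)" for x I
      proof (rule ccontr)
        assume "r0 \<notin> I"
        then have "(\<Union>r\<in>I. ?D x r) = (\<Union>r\<in>I. A r)" by (intro SUP_cong) auto
        then show False using that less.prems(2)[of I] by simp
      qed
      have rI: "r0 \<in> I" and rJ: "r0 \<in> J" using r0_in[OF I] r0_in[OF J] by auto
      have "r0 \<in> I \<inter> J" using rI rJ by simp
      then have "card (I \<inter> J - {r0}) + 1 = card (I \<inter> J)"
        by (metis Suc_eq_plus1 card_Suc_Diff1 finite)
      moreover have "card (I \<union> J) + card (I \<inter> J) = card I + card J"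
        using card_Un_Int[of I J] by simp
      moreover have un: "(\<Union>r\<in>I. ?D x r) \<union> (\<Union>r\<in>J. ?D y r) = (\<Union>r\<in>I\<union>J. A r)"
      proof (intro set_eqI iffI)
        fix b assume "b \<in> (\<Union>r\<in>I\<union>J. A r)"
        then obtain r where r: "r \<in> I \<union> J" "b \<in> A r" by blast
        show "b \<in> (\<Union>r\<in>I. ?D x r) \<union> (\<Union>r\<in>J. ?D y r)"
        proof (cases "r = r0")
          case True
          with r xy have "b \<in> ?D x r0 \<or> b \<in> ?D y r0" by auto
          with rI rJ show ?thesis by blast
        next
          case False
          with r have "b \<in> ?D x r" "b \<in> ?D y r" by auto
          with r(1) show ?thesis by blast
        qed
      qed (auto split: if_splits)
      \<comment> \<open>The intersection on the right may be larger, which is why \<open>h\<close>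
        is assumed to satisfy the inequality for every \<open>C\<close> inside the
        intersection.\<close>
      moreover have "(\<Union>r\<in>I\<inter>J-{r0}. A r) \<subseteq> (\<Union>r\<in>I. ?D x r) \<inter> (\<Union>r\<in>J. ?D y r)"
        by auto
      from h[OF this, unfolded un] have "h (\<Union>r\<in>I. ?D x r) + h (\<Union>r\<in>J. ?D y r)
        \<le> h (\<Union>r\<in>I\<union>J. A r) + h (\<Union>r\<in>I\<inter>J-{r0}. A r)" .
      ultimately show False
        using I J less.prems(2)[of "I \<union> J"] less.prems(2)[of "I \<inter> J - {r0}"] by linarith
    qed
  qed
qed

text \<open>Choose a feasible \<open>c\<close> of largest total. Submodularity makes the union of
  two meeting tight sets tight, and maximality puts every index into a tight set. The largest tight
  sets around the indices are then the blocks.\<close>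

lemma intersecting_submodular_tight_partition:
  fixes g :: "'i set \<Rightarrow> nat"
  assumes L: "finite L"
    and g: "\<And>J J'. J \<subseteq> L \<Longrightarrow> J' \<subseteq> L \<Longrightarrow> J \<inter> J' \<noteq> {} \<Longrightarrow> g (J \<union> J') + g (J \<inter> J') \<le> g J + g J'"
  obtains c :: "'i \<Rightarrow> nat" and P where "partition_on L P"
    "\<And>J. J \<subseteq> L \<Longrightarrow> J \<noteq> {} \<Longrightarrow> sum c J \<le> g J" "\<And>B. B \<in> P \<Longrightarrow> sum c B = g B"
proof -
  define feas where "feas c \<longleftrightarrow> (\<forall>J. J \<subseteq> L \<longrightarrow> J \<noteq> {} \<longrightarrow> sum c J \<le> g J)" for c :: "'i \<Rightarrow> nat"
  have "feas (\<lambda>_. 0)" by (simp add: feas_def)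
  \<comment> \<open>The singleton constraints bound the total of every feasible \<open>c\<close>, so
    a maximum exists.\<close>
  moreover have "\<forall>c. feas c \<longrightarrow> sum c L < Suc (\<Sum>i\<in>L. g {i})"
  proof (intro allI impI le_imp_less_Suc sum_mono)
    fix c i assume "feas c" "i \<in> L"
    then have "{i} \<subseteq> L \<longrightarrow> {i} \<noteq> {} \<longrightarrow> sum c {i} \<le> g {i}" unfolding feas_def by blast
    with \<open>i \<in> L\<close> show "c i \<le> g {i}" by simp
  qed
  ultimately have "\<exists>c. feas c \<and> (\<forall>d. feas d \<longrightarrow> sum d L \<le> sum c L)"
    by (rule ex_has_greatest_nat[where f = "\<lambda>c. sum c L"])
  then obtain c where c: "feas c" and cmax: "\<And>d. feas d \<Longrightarrow> sum d L \<le> sum c L"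
    by blast
  define tight where "tight J \<longleftrightarrow> J \<subseteq> L \<and> sum c J = g J" for J
  have le: "sum c J \<le> g J" if "J \<subseteq> L" "J \<noteq> {}" for J using c that by (simp add: feas_def)
  have tight_Un: "tight (J \<union> J')" if "tight J" "tight J'" "J \<inter> J' \<noteq> {}" for J J'
  proof -
    have sub: "J \<subseteq> L" "J' \<subseteq> L" using that by (auto simp: tight_def)
    then have "sum c (J \<union> J') + sum c (J \<inter> J') = sum c J + sum c J'"
      using L by (intro sum.union_inter) (auto intro: finite_subset)
    moreover have "sum c (J \<union> J') \<le> g (J \<union> J')" "sum c (J \<inter> J') \<le> g (J \<inter> J')"
      using sub that(3) by (auto intro!: le)
    ultimately show ?thesis using g[OF sub that(3)] sub that by (auto simp: tight_def)
  qed
  have ex: "\<exists>J. tight J \<and> i \<in> J" if i: "i \<in> L" for i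
  proof (rule ccontr)
    assume no: "\<not> ?thesis"
    have upd: "sum (c(i := c i + 1)) J = sum c J + (if i \<in> J then 1 else 0)" if "J \<subseteq> L" for J
    proof -
      have fin: "finite J" using that L finite_subset by blast
      have "(c(i := c i + 1)) = (\<lambda>j. c j + (if i = j then 1 else 0))" by auto
      then show ?thesis using fin by (simp add: sum.distrib sum.delta)
    qed
    \<comment> \<open>Every constraint containing \<open>i\<close> has slack at least one, so
      \<open>c i\<close> can be raised, against maximality.\<close>
    have "feas (c(i := c i + 1))" unfolding feas_def
    proof (intro allI impI)
      fix J assume J: "J \<subseteq> L" "J \<noteq> {}"
      show "sum (c(i := c i + 1)) J \<le> g J"
      proof (cases "i \<in> J")
        case True
        with no J(1) have "sum c J \<noteq> g J" by (auto simp: tight_def)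
        with le[OF J] True show ?thesis unfolding upd[OF J(1)] by simp
      qed (use le[OF J] in \<open>simp only: upd[OF J(1)], simp\<close>)
    qed
    from cmax[OF this] upd[of L] i show False by simp
  qed
  define T where "T i = \<Union>{J. tight J \<and> i \<in> J}" for i
  have T: "tight (T i)" "i \<in> T i" if "i \<in> L" for i
  proof -
    have "finite {J. tight J \<and> i \<in> J}"
      by (rule finite_subset[of _ "Pow L"]) (auto simp: tight_def L)
    moreover have "{J. tight J \<and> i \<in> J} \<noteq> {}" using ex[OF that] by auto
    moreover have "finite S \<Longrightarrow> S \<noteq> {} \<Longrightarrow> S \<subseteq> {J. tight J \<and> i \<in> J} \<Longrightarrow> tight (\<Union>S) \<and> i \<in> \<Union>S" for S
    proof (induction rule: finite_ne_induct)
      case (insert J S)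
      then show ?case using tight_Un[of J "\<Union>S"] by auto
    qed auto
    ultimately show "tight (T i)" "i \<in> T i" unfolding T_def by blast+
  qed
  have T_eq: "T j \<subseteq> T i" if "i \<in> L" "j \<in> L" "T i \<inter> T j \<noteq> {}" for i j
  proof -
    have "tight (T i \<union> T j)" using tight_Un T that by blast
    then show ?thesis using T(2)[OF that(1)] unfolding T_def[of i] by blast
  qed
  have "partition_on L (T ` L)"
  proof (rule partition_onI)
    show "\<Union>(T ` L) = L" using T by (auto simp: tight_def)
    show "disjnt p q" if "p \<in> T ` L" "q \<in> T ` L" "p \<noteq> q" for p q
      using that T_eq unfolding disjnt_def by (metis Int_commute image_iff subset_antisym)
    show "{} \<notin> T ` L" using T(2) by auto
  qed
  then show thesis using le T(1) by (intro that[of "T ` L" c]) (auto simp: tight_def)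
qed

text \<open>This distributes the rows: each index \<open>i\<close> receives \<open>c i\<close> of
  them. The pairs of an index and a copy number inject into the rows, and rows outside the image
  stay unlabelled (\<open>None\<close>).\<close>

lemma labelling_with_multiplicities:
  fixes c :: "'i \<Rightarrow> nat"
  assumes "finite L" "sum c L \<le> CARD('k::finite)"
  obtains a :: "'k::finite \<Rightarrow> 'i option" where "\<And>r i. a r = Some i \<Longrightarrow> i \<in> L"
    "\<And>J. J \<subseteq> L \<Longrightarrow> card {r. a r \<in> Some ` J} = sum c J"
proof -
  let ?S = "Sigma L (\<lambda>i. {..<c i})"
  have "card ?S \<le> CARD('k)" using assms by simp
  then obtain f :: "_ \<Rightarrow> 'k" where f: "inj_on f ?S"
    using card_le_inj[of ?S "UNIV :: 'k set"] assms(1) by auto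
  define a where "a r = (if r \<in> f ` ?S then Some (fst (the_inv_into ?S f r)) else None)" for r
  have a: "a (f s) = Some (fst s)" if "s \<in> ?S" for s
    using that the_inv_into_f_f[OF f that] by (simp add: a_def)
  show thesis
  proof (rule that[of a])
    show "i \<in> L" if "a r = Some i" for r i
    proof -
      from that have "r \<in> f ` ?S" by (auto simp: a_def split: if_splits)
      then show ?thesis using a that by auto
    qed
    fix J assume J: "J \<subseteq> L"
    have "{r. a r \<in> Some ` J} = f ` Sigma J (\<lambda>i. {..<c i})"
    proof (intro set_eqI iffI)
      fix r assume r: "r \<in> {r. a r \<in> Some ` J}"
      then have "r \<in> f ` ?S" by (auto simp: a_def split: if_splits)
      then show "r \<in> f ` Sigma J (\<lambda>i. {..<c i})" using a r by auto
    qed (use a J in auto)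
    moreover have "inj_on f (Sigma J (\<lambda>i. {..<c i}))"
      by (rule inj_on_subset[OF f]) (use J in auto)
    ultimately show "card {r. a r \<in> Some ` J} = sum c J"
      using finite_subset[OF J assms(1)] by (simp add: card_image)
  qed
qed

section \<open>Specialisation of matrices\<close>

text \<open>Rado's theorem is applied to the sets of rows of the \<open>Q r\<close>, with
  \<open>h B\<close> the dimension of the part of \<open>V\<close> orthogonal to \<open>B\<close>.
  The resulting \<open>z\<close> has entries 0 and 1, so a finite field need not be
  enlarged.\<close>

lemma injective_row_specialisation_exists:
  fixes V :: "('a::field ^ 'n) set" and Q :: "'k::finite \<Rightarrow> 'a ^ 'n ^ 'm"
  assumes V: "vec.subspace V"
    and hall: "\<And>I. vec.dim {v \<in> V. \<forall>r\<in>I. Q r *v v = 0} + card I \<le> CARD('k)"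
  obtains z :: "'k \<Rightarrow> 'm \<Rightarrow> 'a" where
    "\<And>v. v \<in> V \<Longrightarrow> \<forall>r. (\<Sum>s\<in>UNIV. z r s * (Q r *v v) $ s) = 0 \<Longrightarrow> v = 0"
proof -
  define N where "N B = {v \<in> V. \<forall>b\<in>B. (\<Sum>j\<in>UNIV. b $ j * v $ j) = 0}" for B :: "('a ^ 'n) set"
  have sub: "vec.subspace (N B)" for B
    using V unfolding N_def vec.subspace_def
    by (auto simp: distrib_left sum.distrib mult.left_commute[of _ _ "_ $ _"] sum_distrib_left[symmetric])
  define A where "A r = range (\<lambda>s. Q r $ s)" for r
  have NA: "N (\<Union>r\<in>I. A r) = {v \<in> V. \<forall>r\<in>I. Q r *v v = 0}" for I
    by (auto simp: N_def A_def vec_eq_iff matrix_vector_mult_def)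
  have "\<exists>A'. (\<forall>r. A' r \<subseteq> A r \<and> card (A' r) \<le> 1) \<and> vec.dim (N (\<Union>r. A' r)) = 0"
  proof (rule supermodular_transversal)
    fix B B' C :: "('a ^ 'n) set" assume C: "C \<subseteq> B \<inter> B'"
    have "vec.dim {x + y |x y. x \<in> N B \<and> y \<in> N B'} + vec.dim (N B \<inter> N B') = vec.dim (N B) + vec.dim (N B')"
      by (rule vec.dim_sums_Int[OF sub sub])
    \<comment> \<open>Supermodularity holds because both summands, hence their sum, are orthogonal
      to every common subset \<open>C\<close>.\<close>
    moreover have "vec.dim {x + y |x y. x \<in> N B \<and> y \<in> N B'} \<le> vec.dim (N C)"
    proof (rule vec.dim_subset, clarify)
      fix x y assume "x \<in> N B" "y \<in> N B'"
      then have "x \<in> N C" "y \<in> N C" using C by (auto simp: N_def)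
      then show "x + y \<in> N C" using sub vec.subspace_add by blast
    qed
    moreover have "N B \<inter> N B' = N (B \<union> B')" by (auto simp: N_def)
    ultimately show "vec.dim (N B) + vec.dim (N B') \<le> vec.dim (N (B \<union> B')) + vec.dim (N C)"
      by simp
  next
    show "finite (A r)" for r by (simp add: A_def)
    show "vec.dim (N (\<Union>r\<in>I. A r)) + card I \<le> CARD('k)" for I
      using hall by (simp add: NA)
  qed
  then obtain A' where A': "\<And>r. A' r \<subseteq> A r" "\<And>r. card (A' r) \<le> 1" "vec.dim (N (\<Union>r. A' r)) = 0"
    by blast
  \<comment> \<open>Row \<open>r\<close> of \<open>z\<close> selects the chosen row of
    \<open>Q r\<close>, or is zero if none was chosen. Equal rows of \<open>Q r\<close> may have
    several indices, of which one is fixed.\<close>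
  define z where "z r s = (if \<exists>b. b \<in> A' r then if s = (SOME s. Q r $ s \<in> A' r) then 1 else 0 else 0 :: 'a)" for r s
  show thesis
  proof (rule that[of z])
    fix v assume v: "v \<in> V" "\<forall>r. (\<Sum>s\<in>UNIV. z r s * (Q r *v v) $ s) = 0"
    have "(\<Sum>j\<in>UNIV. b $ j * v $ j) = 0" if b: "b \<in> A' r" for r b
    proof -
      define s where "s = (SOME s. Q r $ s \<in> A' r)"
      have "\<exists>s. Q r $ s \<in> A' r" using b A'(1)[of r] by (auto simp: A_def)
      then have "Q r $ s \<in> A' r" unfolding s_def by (rule someI_ex)
      moreover have "finite (A' r)" using A'(1)[of r] by (rule finite_subset) (simp add: A_def)
      ultimately have bs: "b = Q r $ s"
        using A'(2)[of r] b by (metis One_nat_def card_le_Suc0_iff_eq)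
      have "z r s' * (Q r *v v) $ s' = (if s' = s then (Q r *v v) $ s' else 0)" for s'
        using b by (auto simp: z_def s_def)
      then have "(Q r *v v) $ s = 0" using v(2)[rule_format, of r] by (simp add: sum.delta)
      then show ?thesis by (simp add: bs matrix_vector_mult_def)
    qed
    with v(1) have "v \<in> N (\<Union>r. A' r)" by (auto simp: N_def)
    with A'(3) show "v = 0" by auto
  qed
qed

text \<open>Multilinearity in row \<rho>: the determinants on the left are the cofactors along that
  row.\<close>

lemma det_replaced_row_expansion:
  fixes X :: "'r::comm_ring_1 ^ 'k ^ 'k"
  shows "(\<Sum>s\<in>UNIV. det (\<chi> t. if t = \<rho> then axis s 1 else X $ t) * y $ s) = det (\<chi> t. if t = \<rho> then y else X $ t)"
proof -
  have "det (\<chi> t. if t = \<rho> then y else X $ t)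
    = det (\<chi> t. if t = \<rho> then (\<Sum>s\<in>UNIV. y $ s *s axis s 1) else X $ t)"
    by (simp only: basis_expansion)
  then show ?thesis
    by (simp add: det_linear_row_sum det_row_mul mult.commute)
qed

text \<open>The coordinates of \<open>u\<close> are the cofactors of a row \<open>axis r 1\<close> in a matrix that contains all \<open>p i\<close>.\<close>
lemma annihilator_specialising_to_axis:
  fixes \<phi> :: "'r::comm_ring_1 \<Rightarrow> 'a::field" and p :: "'i \<Rightarrow> 'r ^ 'k" and r :: 'k
  assumes "unital_ring_hom \<phi>"
    and inj: "inj_on (\<lambda>i. unital_ring_hom.mapv \<phi> (p i)) I"
    and ind: "vec.independent ((\<lambda>i. unital_ring_hom.mapv \<phi> (p i)) ` I)"
    and vanish: "\<And>i. i \<in> I \<Longrightarrow> \<phi> (p i $ r) = 0"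
  obtains u d where "d \<noteq> 0" "unital_ring_hom.mapv \<phi> u = d *s axis r 1"
    "\<And>i. i \<in> I \<Longrightarrow> (\<Sum>s\<in>UNIV. u $ s * p i $ s) = 0"
proof -
  interpret unital_ring_hom \<phi> by fact
  \<comment> \<open>The new index \<open>None\<close> carries the unit vector. It is independent of
    the specialised family, which lies in the hyperplane where coordinate \<open>r\<close>
    vanishes.\<close>
  define p' where "p' = case_option (axis r 1) p"
  let ?I = "insert None (Some ` I)"
  have "(\<lambda>i. mapv (p i)) ` I \<subseteq> {x. x $ r = 0}" using vanish by auto
  moreover have "vec.subspace {x :: 'a ^ 'k. x $ r = 0}" by (auto simp: vec.subspace_def)
  ultimately have "vec.span ((\<lambda>i. mapv (p i)) ` I) \<subseteq> {x. x $ r = 0}"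
    by (rule vec.span_minimal)
  then have notin: "axis r 1 \<notin> vec.span ((\<lambda>i. mapv (p i)) ` I)" by (auto simp: axis_def)
  have im: "(\<lambda>i. mapv (p' i)) ` ?I = insert (axis r 1) ((\<lambda>i. mapv (p i)) ` I)"
    by (auto simp: p'_def image_image)
  have ind': "vec.independent ((\<lambda>i. mapv (p' i)) ` ?I)"
    unfolding im using notin ind by (rule vec.independent_insertI)
  have inj': "inj_on (\<lambda>i. mapv (p' i)) ?I"
  proof (rule inj_on_insert[THEN iffD2], intro conjI)
    show "inj_on (\<lambda>i. mapv (p' i)) (Some ` I)"
      using inj by (auto simp: inj_on_def p'_def)
    have "axis r 1 \<notin> (\<lambda>i. mapv (p i)) ` I"
      using notin by (metis vec.span_base)
    then show "mapv (p' None) \<notin> (\<lambda>i. mapv (p' i)) ` (Some ` I - {None})"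
      by (auto simp: p'_def)
  qed
  obtain f :: "'k \<Rightarrow> 'i option + 'k" where f: "\<And>i. i \<in> ?I \<longleftrightarrow> (\<exists>s. f s = Inl i)"
    "det (\<chi> s. case f s of Inl i \<Rightarrow> mapv (p' i) | Inr t \<Rightarrow> axis t 1) \<noteq> 0"
    by (rule independent_family_extend_det[OF inj' ind']) (rule that)
  define X where "X = (\<chi> s. case f s of Inl i \<Rightarrow> p' i | Inr t \<Rightarrow> axis t 1)"
  obtain \<rho> where \<rho>: "f \<rho> = Inl None" using f(1)[of None] by auto
  define u where "u = (\<chi> s. det (\<chi> t. if t = \<rho> then axis s 1 else X $ t))"
  have X\<rho>: "X $ \<rho> = axis r 1" by (simp add: X_def \<rho> p'_def)
  have Xeq: "(\<chi> s. mapv (X $ s)) = (\<chi> s. case f s of Inl i \<Rightarrow> mapv (p' i) | Inr t \<Rightarrow> axis t 1)"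
    unfolding X_def by (intro Cart_lambda_cong) (simp split: sum.split)
  then have dX: "det (\<chi> s. mapv (X $ s)) \<noteq> 0" using f(2) by metis
  have u_r: "\<phi> (u $ r) = det (\<chi> s. mapv (X $ s))"
  proof -
    have "(\<chi> t. if t = \<rho> then axis r 1 else X $ t) = X" using X\<rho> by (auto simp: vec_eq_iff)
    then show ?thesis by (simp add: u_def hom_det)
  qed
  \<comment> \<open>Away from row \<rho>, the rows \<open>p i\<close> specialise to 0 in column
    \<open>r\<close> by hypothesis, and a unit row \<open>axis r 1\<close> would repeat row \<rho>.
    Hence for \<open>s \<noteq> r\<close> the specialised cofactor has a zero column.\<close>
  have Xr0: "\<phi> (X $ t $ r) = 0" if t: "t \<noteq> \<rho>" for t
  proof (rule ccontr)
    assume nz: "\<phi> (X $ t $ r) \<noteq> 0"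
    have "X $ t = axis r 1"
    proof (cases "f t")
      case (Inl i)
      then have "i \<in> ?I" using f(1) by blast
      with nz vanish Inl show ?thesis by (auto simp: X_def p'_def)
    next
      case (Inr b)
      with nz show ?thesis by (auto simp: X_def axis_def zero split: if_splits)
    qed
    then have "row t (\<chi> s. mapv (X $ s)) = row \<rho> (\<chi> s. mapv (X $ s))"
      using X\<rho> by (simp add: row_def)
    with t dX show False using det_identical_rows by blast
  qed
  have u_s: "\<phi> (u $ s) = 0" if s: "s \<noteq> r" for s
  proof -
    have "\<phi> (u $ s) = det (\<chi> t. mapv (if t = \<rho> then axis s 1 else X $ t))"
      by (simp add: u_def hom_det)
    moreover have "column r (\<chi> t. mapv (if t = \<rho> then axis s 1 else X $ t)) = 0"
      using Xr0 s by (auto simp: column_def vec_eq_iff axis_def zero)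
    ultimately show ?thesis using det_zero_column(2) by metis
  qed
  show thesis
  proof (rule that[of "\<phi> (u $ r)" u])
    show "\<phi> (u $ r) \<noteq> 0" using u_r dX by simp
    show "mapv u = \<phi> (u $ r) *s axis r 1" using u_s by (auto simp: vec_eq_iff axis_def)
    fix i assume "i \<in> I"
    then obtain t where t: "f t = Inl (Some i)" using f(1) by blast
    have "t \<noteq> \<rho>" using t \<rho> by auto
    \<comment> \<open>Pairing \<open>u\<close> with \<open>p i\<close> puts \<open>p i\<close> into
      row \<rho>, although it already stands in row \<open>t\<close>.\<close>
    moreover have "row t (\<chi> t. if t = \<rho> then p i else X $ t) = row \<rho> (\<chi> t. if t = \<rho> then p i else X $ t)"
      using t \<open>t \<noteq> \<rho>\<close> by (simp add: row_def X_def p'_def)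
    ultimately show "(\<Sum>s\<in>UNIV. u $ s * p i $ s) = 0"
      unfolding u_def by (simp add: det_replaced_row_expansion det_identical_rows)
  qed
qed

text \<open>Completed by unit rows, the vectors \<open>u r\<close> form a matrix whose
  specialisation is diagonal and nonsingular. It is therefore nonsingular over the target of \<iota>
  too, and maps \<open>Y\<close> injectively into the vectors vanishing on \<open>D\<close>.\<close>

lemma dim_le_of_specialised_annihilators:
  fixes \<phi> :: "'r::comm_ring_1 \<Rightarrow> 'a::field" and \<iota> :: "'r \<Rightarrow> 'b::field"
    and u :: "'k \<Rightarrow> 'r ^ 'k" and Y :: "('b ^ 'k) set"
  assumes "unital_ring_hom \<phi>" "unital_ring_hom \<iota>" "inj \<iota>"
    and u: "\<And>r. r \<in> D \<Longrightarrow> d r \<noteq> 0" "\<And>r. r \<in> D \<Longrightarrow> unital_ring_hom.mapv \<phi> (u r) = d r *s axis r 1"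
    and Y: "\<And>r y. r \<in> D \<Longrightarrow> y \<in> Y \<Longrightarrow> (\<Sum>s\<in>UNIV. \<iota> (u r $ s) * y $ s) = 0"
  shows "vec.dim Y + card D \<le> CARD('k)"
proof -
  interpret \<phi>: unital_ring_hom \<phi> by fact
  interpret \<iota>: unital_ring_hom \<iota> by fact
  define U where "U = (\<chi> r. if r \<in> D then u r else axis r 1)"
  have U: "(\<chi> r. \<phi>.mapv (U $ r)) $ r = (if r \<in> D then d r else 1) *s axis r 1" for r
    using u(2)[of r] by (auto simp: U_def vec_eq_iff axis_def \<phi>.zero \<phi>.one)
  have "det (\<chi> r. \<phi>.mapv (U $ r)) = (\<Prod>r\<in>UNIV. (\<chi> r. \<phi>.mapv (U $ r)) $ r $ r)"
    by (rule det_diagonal) (simp only: U, simp add: axis_def)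
  also have "\<dots> = (\<Prod>r\<in>UNIV. if r \<in> D then d r else 1)"
    by (simp only: U) (simp add: axis_def)
  also have "\<dots> \<noteq> 0" using u(1) by (auto simp: prod_zero_iff)
  finally have "det U \<noteq> 0" using \<phi>.hom_det[of U] \<phi>.zero by metis
  define A where "A = (\<chi> r. \<iota>.mapv (U $ r))"
  have "det A \<noteq> 0"
    using \<open>det U \<noteq> 0\<close> \<iota>.hom_det[of U] \<iota>.zero assms(3) unfolding A_def by (metis injD)
  then have "inj ((*v) A)" using invertible_det_nz inj_matrix_vector_mult by blast
  then have "vec.dim Y = vec.dim ((*v) A ` Y)"
    by (metis vec.dim_image_eq matrix_vector_mul_linear_gen inj_on_subset subset_UNIV)
  also have "\<dots> \<le> vec.dim {x :: 'b ^ 'k. \<forall>i. i \<notin> - D \<longrightarrow> x $ i = 0}"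
  proof (rule vec.dim_subset, clarsimp)
    fix y i assume "y \<in> Y" "i \<in> D"
    then show "(A *v y) $ i = 0" using Y by (simp add: A_def U_def matrix_vector_mult_def)
  qed
  also have "\<dots> = card (- D)" by (rule dim_substandard_cart)
  finally show ?thesis using card_mono[of UNIV D] by (simp add: Compl_eq_Diff_UNIV card_Diff_subset)
qed

section \<open>The generic matrix\<close>

definition cpoly :: "'a::field \<Rightarrow> ('a, 'k::{finite,linorder}, 'n::{finite,linorder}) mpoly" where
  "cpoly c = Poly_Mapping.single 0 c"

definition Zpoly :: "'k::{finite,linorder} \<Rightarrow> 'n::{finite,linorder} \<Rightarrow> ('a::field, 'k, 'n) mpoly" where
  "Zpoly i j = Poly_Mapping.single (Poly_Mapping.single i (Poly_Mapping.single j 1)) 1"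

text \<open>The image of \<open>v\<close> under the matrix with rows \<open>z\<^sub>r Q\<^sub>r\<close>, where \<open>z\<^sub>r\<close> is the \<open>r\<close>-th row of the generic matrix.\<close>
definition twisted_image :: "('k::{finite,linorder} \<Rightarrow> 'a::field ^ 'n::{finite,linorder} ^ 'n::{finite,linorder}) \<Rightarrow> 'a ^ 'n::{finite,linorder} \<Rightarrow> ('a, 'k, 'n) mpoly ^ 'k::{finite,linorder}" where
  "twisted_image Q v = (\<chi> r. \<Sum>s\<in>UNIV. Zpoly r s * cpoly ((Q r *v v) $ s))"

lemma const_rf_eq: "const_rf c = to_fract (cpoly c)"
  by (simp add: const_rf_def cpoly_def to_fract_def)

lemma Zvar_eq: "Zvar i j = to_fract (Zpoly i j)"
  by (simp add: Zvar_def Zpoly_def to_fract_def)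

lemma unital_ring_hom_cpoly: "unital_ring_hom cpoly"
  by unfold_locales (simp_all add: cpoly_def single_add mult_single)

lemma unital_ring_hom_const_rf:
  "unital_ring_hom (const_rf :: 'a::field \<Rightarrow> ('a, 'k::{finite,linorder}, 'n::{finite,linorder}) ratfun)"
proof -
  interpret unital_ring_hom "cpoly :: 'a \<Rightarrow> ('a, 'k, 'n) mpoly" by (rule unital_ring_hom_cpoly)
  show ?thesis by unfold_locales (simp_all add: const_rf_eq add mult one)
qed

lemma eval_mpoly_cpoly: "unital_ring_hom g \<Longrightarrow> eval_mpoly g z (cpoly c) = g c"
  by (simp add: cpoly_def)

lemma eval_mpoly_Zpoly: "unital_ring_hom g \<Longrightarrow> eval_mpoly g z (Zpoly i j) = z i j"
  by (simp add: Zpoly_def unital_ring_hom.one del: One_nat_def)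

lemma unital_ring_hom_id: "unital_ring_hom (\<lambda>x. x)"
  by unfold_locales simp_all

lemma inj_to_fract: "inj to_fract"
  by (simp add: inj_def)

text \<open>The Hall-type condition provides values \<open>z\<close> for the indeterminates at which
  the twisted map is injective on the span of \<open>B\<close>. Independence after evaluation lifts
  to the field of fractions.\<close>

lemma twisted_image_independent:
  fixes V :: "('a::field ^ 'n::{finite,linorder}) set" and Q :: "'k::{finite,linorder} \<Rightarrow> 'a ^ 'n::{finite,linorder} ^ 'n::{finite,linorder}"
  assumes hall: "\<And>I. vec.dim {v \<in> vec.span B. \<forall>r\<in>I. Q r *v v = 0} + card I \<le> CARD('k)"
    and B: "vec.independent B"
  shows "inj_on (\<lambda>b. unital_ring_hom.mapv to_fract (twisted_image Q b)) B"
    "vec.independent ((\<lambda>b. unital_ring_hom.mapv to_fract (twisted_image Q b)) ` B)"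
proof -
  obtain z :: "'k \<Rightarrow> 'n \<Rightarrow> 'a" where z:
    "\<And>v. v \<in> vec.span B \<Longrightarrow> \<forall>r. (\<Sum>s\<in>UNIV. z r s * (Q r *v v) $ s) = 0 \<Longrightarrow> v = 0"
    using injective_row_specialisation_exists[OF vec.subspace_span hall] by blast
  define \<psi> where "\<psi> = eval_mpoly (\<lambda>x. x) z"
  interpret \<psi>: unital_ring_hom \<psi>
    unfolding \<psi>_def by (rule unital_ring_hom_eval_mpoly[OF unital_ring_hom_id])
  define T where "T v = (\<chi> r. \<Sum>s\<in>UNIV. z r s * (Q r *v v) $ s)" for v
  have T: "\<psi>.mapv (twisted_image Q v) = T v" for v
    by (simp add: vec_eq_iff twisted_image_def T_def \<psi>.sum \<psi>.mult)
       (simp add: \<psi>_def eval_mpoly_cpoly eval_mpoly_Zpoly unital_ring_hom_id)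
  have lin: "Vector_Spaces.linear (*s) (*s) T"
    by unfold_locales (simp_all add: T_def vec_eq_iff vec.add vec.scale distrib_left sum.distrib sum_distrib_left mult.left_commute)
  have inj: "inj_on T (vec.span B)"
  proof (subst vec.linear_inj_on_iff_eq_0[OF lin vec.subspace_span], clarify)
    fix v assume "v \<in> vec.span B" "T v = 0"
    then show "v = 0" using z[of v] by (simp add: T_def vec_eq_iff)
  qed
  have 1: "inj_on (\<lambda>b. \<psi>.mapv (twisted_image Q b)) B"
    unfolding T using inj vec.span_superset inj_on_subset by blast
  have 2: "vec.independent ((\<lambda>b. \<psi>.mapv (twisted_image Q b)) ` B)"
    unfolding T using vec.linear_independent_injective_image[OF lin B inj] .
  note L = independent_family_lift[OF \<psi>.unital_ring_hom_axioms unital_ring_hom_to_fract inj_to_fract 1 2]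
  show "inj_on (\<lambda>b. unital_ring_hom.mapv to_fract (twisted_image Q b)) B" by (rule L(1))
  show "vec.independent ((\<lambda>b. unital_ring_hom.mapv to_fract (twisted_image Q b)) ` B)" by (rule L(2))
qed

section \<open>The spaces W_V: spanning sets and dimension\<close>

lemma Wmat_embed_vec:
  "(Wmat :: ('a::field, 'k::{finite,linorder}, 'n::{finite,linorder}) ratfun ^ 'n::{finite,linorder} ^ 'k::{finite,linorder}) *v embed_vec v
    = unital_ring_hom.mapv to_fract (twisted_image (\<lambda>_. mat 1) v)"
proof -
  interpret unital_ring_hom "to_fract :: ('a, 'k, 'n) mpoly \<Rightarrow> _" by (rule unital_ring_hom_to_fract)
  have "(twisted_image (\<lambda>_. mat 1) v :: ('a, 'k, 'n) mpoly ^ 'k::{finite,linorder}) = (\<chi> r. \<Sum>s\<in>UNIV. Zpoly r s * cpoly (v $ s))"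
    by (simp add: twisted_image_def)
  then show ?thesis
    by (simp add: vec_eq_iff matrix_vector_mult_def Wmat_def embed_vec_def sum Zvar_eq const_rf_eq)
qed

text \<open>The map from \<open>v\<close> to W \<open>v\<close> is additive and respects constants,
  so a spanning set of V suffices. This recovers the description of W_V by the columns of
  WA.\<close>

lemma W_sub_span:
  fixes B :: "('a::field ^ 'n::{finite,linorder}) set"
  shows "(W_sub (vec.span B) :: (('a, 'k::{finite,linorder}, 'n) ratfun ^ 'k::{finite,linorder}) set)
    = vec.span ((\<lambda>b. Wmat *v embed_vec b) ` B)" (is "?l = vec.span (?w ` B)")
proof -
  let ?e = "embed_vec :: _ \<Rightarrow> ('a, 'k, 'n) ratfun ^ 'n::{finite,linorder}"
  interpret unital_ring_hom "const_rf :: 'a \<Rightarrow> ('a, 'k, 'n) ratfun" by (rule unital_ring_hom_const_rf)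
  have "?w v \<in> vec.span (?w ` B)" if "v \<in> vec.span B" for v
    using that
  proof (induction rule: vec.span_induct_alt)
    case base
    have "?e 0 = 0" by (simp add: embed_vec_def vec_eq_iff zero)
    then show ?case by (simp add: vec.span_zero)
  next
    case (step c x y)
    have "?e (c *s x + y) = const_rf c *s ?e x + ?e y"
      by (simp add: embed_vec_def vec_eq_iff add mult)
    with step show ?case
      by (simp add: vec.add vec.scale vec.span_add vec.span_scale vec.span_base)
  qed
  then have "?l \<subseteq> vec.span (?w ` B)"
    unfolding W_sub_def by (intro vec.span_minimal) auto
  moreover have "vec.span (?w ` B) \<subseteq> ?l"
    unfolding W_sub_def by (intro vec.span_mono image_mono vec.span_superset)
  ultimately show ?thesis by blast
qed

text \<open>This is the untwisted case: the identity kills no nonzero vector, so the Hall-type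
  condition has content only for empty \<open>I\<close>, where it is the bound on
  \<open>vec.dim V\<close>.\<close>

lemma dim_W_sub:
  fixes V :: "('a::field ^ 'n::{finite,linorder}) set"
  assumes V: "vec.subspace V" and dim: "vec.dim V \<le> CARD('k::{finite,linorder})"
  shows "vec.dim (W_sub V :: (('a, 'k::{finite,linorder}, 'n) ratfun ^ 'k::{finite,linorder}) set) = vec.dim V"
proof -
  obtain B where B: "B \<subseteq> V" "vec.independent B" "V \<subseteq> vec.span B" "card B = vec.dim V"
    using vec.basis_exists[of V] by metis
  have span: "vec.span B = V" using B(1,3) V vec.span_minimal by blast
  let ?w = "\<lambda>b. (Wmat :: ('a, 'k, 'n) ratfun ^ 'n::{finite,linorder} ^ 'k::{finite,linorder}) *v embed_vec b"
  have hall: "vec.dim {v \<in> vec.span B. \<forall>r\<in>I. (\<lambda>_. mat 1 :: 'a ^ 'n::{finite,linorder} ^ 'n::{finite,linorder}) r *v v = 0} + card I \<le> CARD('k)" for I :: "'k set"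
  proof (cases "I = {}")
    case True
    then show ?thesis using dim by (simp add: span)
  next
    case False
    then have "{v \<in> vec.span B. \<forall>r\<in>I. (\<lambda>_. mat 1 :: 'a ^ 'n::{finite,linorder} ^ 'n::{finite,linorder}) r *v v = 0} \<subseteq> {0}" by auto
    then have "vec.dim {v \<in> vec.span B. \<forall>r\<in>I. (\<lambda>_. mat 1 :: 'a ^ 'n::{finite,linorder} ^ 'n::{finite,linorder}) r *v v = 0} = 0"
      by (simp only: vec.dim_eq_0)
    then show ?thesis by (metis add_0 card_mono finite subset_UNIV)
  qed
  note ind = twisted_image_independent[OF hall B(2), folded Wmat_embed_vec]
  have "vec.dim (W_sub V :: (('a, 'k, 'n) ratfun ^ 'k::{finite,linorder}) set) = vec.dim (vec.span (?w ` B))"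
    using W_sub_span[of B, where 'k = 'k] by (simp only: span)
  also have "\<dots> = card (?w ` B)" by (rule vec.dim_span_eq_card_independent[OF ind(2)])
  also have "\<dots> = card B" by (rule card_image[OF ind(1)])
  finally show ?thesis using B(4) by simp
qed

lemma W_sub_mono: "V \<subseteq> V' \<Longrightarrow> W_sub V \<subseteq> W_sub V'"
  unfolding W_sub_def by (intro vec.span_mono image_mono)

text \<open>A projection along \<open>U\<close> serves: it kills a basis of \<open>U\<close> and
  fixes the added basis vectors. Multiplying a generic row by such a matrix makes the row vanish on
  \<open>U\<close>.\<close>

lemma kernel_matrix_exists:
  fixes U :: "('a::field ^ 'n) set"
  assumes "vec.subspace U"
  obtains K :: "'a ^ 'n ^ 'n" where "\<And>v. K *v v = 0 \<longleftrightarrow> v \<in> U"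
proof -
  obtain B where B: "B \<subseteq> U" "vec.independent B" "U \<subseteq> vec.span B"
    using vec.basis_exists[of U] by metis
  have span: "vec.span B = U" using B(1,3) assms vec.span_minimal by blast
  let ?C = "vec.extend_basis B"
  obtain f where f: "Vector_Spaces.linear (*s) (*s) f" "\<forall>x\<in>?C. f x = (if x \<in> B then 0 else x)"
    using vec.linear_independent_extend[OF vec.independent_extend_basis[OF B(2)],
        of "\<lambda>x. if x \<in> B then 0 else x"] by blast
  interpret f: Vector_Spaces.linear "(*s)" "(*s)" f by (rule f(1))
  have BC: "B \<subseteq> ?C" by (rule vec.extend_basis_superset[OF B(2)])
  \<comment> \<open>Every vector differs from its projection by an element of \<open>U\<close>, so
    the kernel is no larger than \<open>U\<close>.\<close>
  have "vec.span ?C \<subseteq> {v. v - f v \<in> U}"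
  proof (rule vec.span_minimal)
    show "?C \<subseteq> {v. v - f v \<in> U}" using f(2) B(1) vec.subspace_0[OF assms] by auto
    have add: "x + y - f (x + y) = (x - f x) + (y - f y)" for x y by (simp add: f.add)
    have scale: "c *s x - f (c *s x) = c *s (x - f x)" for c x
      by (simp add: f.scale vec.scale_right_diff_distrib)
    show "vec.subspace {v. v - f v \<in> U}"
      by (rule vec.subspaceI)
        (simp_all only: mem_Collect_eq add scale f.zero diff_zero vec.subspace_0[OF assms]
          vec.subspace_add[OF assms] vec.subspace_scale[OF assms])
  qed
  then have 1: "v - f v \<in> U" for v using vec.span_extend_basis[OF B(2)] by auto
  have 2: "f v = 0" if "v \<in> U" for v
    using f.eq_0_on_span[of B v] f(2) BC that span by (simp add: subset_iff)
  show thesis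
    using 1 2 matrix_works[OF f(1)] by (intro that[of "matrix f"]) (metis diff_zero)
qed

text \<open>Each further subspace costs at most its codimension, because a sum of two subspaces has
  dimension at most k.\<close>

lemma dim_INT_ge:
  fixes S :: "'b \<Rightarrow> ('a::field ^ 'k) set"
  assumes "finite P" "P \<noteq> {}" "\<And>B. B \<in> P \<Longrightarrow> vec.subspace (S B)"
  shows "(\<Sum>B\<in>P. int (vec.dim (S B))) - (int (card P) - 1) * int CARD('k) \<le> int (vec.dim (\<Inter>B\<in>P. S B))"
  using assms
proof (induction rule: finite_ne_induct)
  case (insert B P)
  have "vec.dim {x + y |x y. x \<in> S B \<and> y \<in> (\<Inter>B\<in>P. S B)} + vec.dim (S B \<inter> (\<Inter>B\<in>P. S B))
    = vec.dim (S B) + vec.dim (\<Inter>B\<in>P. S B)"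
    using insert.prems by (intro vec.dim_sums_Int vec.subspace_Inter) auto
  moreover have "vec.dim {x + y |x y. x \<in> S B \<and> y \<in> (\<Inter>B\<in>P. S B)} \<le> CARD('k)"
    by (rule dim_subset_UNIV_cart_gen)
  ultimately have "int (vec.dim (S B)) + int (vec.dim (\<Inter>B\<in>P. S B)) - int CARD('k) \<le> int (vec.dim (\<Inter>B\<in>insert B P. S B))"
    by simp
  then show ?case using insert by (simp add: algebra_simps)
qed simp

section \<open>Dimension of the intersection\<close>

text \<open>Any feasible \<open>c\<close> bounds the dimension from above: each of the
  \<open>sum c L\<close> labelled rows yields one functional vanishing on the intersection.\<close>

lemma dim_INT_W_sub_le:
  fixes V :: "'i \<Rightarrow> ('a::field ^ 'n::{finite,linorder}) set" and c :: "'i \<Rightarrow> nat"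
  assumes L: "finite L" "L \<noteq> {}"
    and V: "\<And>i. i \<in> L \<Longrightarrow> vec.subspace (V i)"
    and c: "\<And>J. J \<subseteq> L \<Longrightarrow> J \<noteq> {} \<Longrightarrow> vec.dim (\<Inter>j\<in>J. V j) + sum c J \<le> CARD('k::{finite,linorder})"
  shows "vec.dim (\<Inter>i\<in>L. W_sub (V i) :: (('a, 'k, 'n) ratfun ^ 'k::{finite,linorder}) set) + sum c L \<le> CARD('k)"
proof -
  have "sum c L \<le> CARD('k)" using c[of L] L by simp
  then obtain a :: "'k \<Rightarrow> 'i option" where a: "\<And>r i. a r = Some i \<Longrightarrow> i \<in> L"
    "\<And>J. J \<subseteq> L \<Longrightarrow> card {r. a r \<in> Some ` J} = sum c J"
    using labelling_with_multiplicities[OF L(1)] by blast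
  have "\<exists>K :: 'a ^ 'n::{finite,linorder} ^ 'n::{finite,linorder}. \<forall>v. K *v v = 0 \<longleftrightarrow> v \<in> V i" if "i \<in> L" for i
    using kernel_matrix_exists[OF V[OF that]] by metis
  then obtain K :: "'i \<Rightarrow> 'a ^ 'n::{finite,linorder} ^ 'n::{finite,linorder}"
    where K: "\<And>i v. i \<in> L \<Longrightarrow> K i *v v = 0 \<longleftrightarrow> v \<in> V i"
    by metis
  define Q where "Q r = (case a r of None \<Rightarrow> mat 1 | Some i \<Rightarrow> K i)" for r
  \<comment> \<open>An unlabelled row in \<open>I\<close> leaves only the zero vector. Otherwise let
    \<open>J\<close> consist of \<open>i\<close> and the labels in \<open>I\<close>: the common
    kernel lies in the intersection over \<open>J\<close>, and at most \<open>sum c J\<close> rows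
    carry labels from \<open>J\<close>.\<close>
  have hall: "vec.dim {v \<in> V i. \<forall>r\<in>I. Q r *v v = 0} + card I \<le> CARD('k)" if i: "i \<in> L" for i I
  proof (cases "\<exists>r\<in>I. a r = None")
    case True
    then have "{v \<in> V i. \<forall>r\<in>I. Q r *v v = 0} \<subseteq> {0}" by (auto simp: Q_def)
    then have "vec.dim {v \<in> V i. \<forall>r\<in>I. Q r *v v = 0} = 0" by (simp only: vec.dim_eq_0)
    then show ?thesis by (metis add_0 card_mono finite subset_UNIV)
  next
    case False
    define J where "J = insert i {j. \<exists>r\<in>I. a r = Some j}"
    have J: "J \<subseteq> L" "J \<noteq> {}" using i a(1) by (auto simp: J_def)
    have "{v \<in> V i. \<forall>r\<in>I. Q r *v v = 0} \<subseteq> (\<Inter>j\<in>J. V j)"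
    proof clarify
      fix v j assume v: "v \<in> V i" "\<forall>r\<in>I. Q r *v v = 0" and j: "j \<in> J"
      show "v \<in> V j"
      proof (cases "j = i")
        case False
        with j obtain r where r: "r \<in> I" "a r = Some j" by (auto simp: J_def)
        then have "K j *v v = 0" using v(2) by (auto simp: Q_def)
        then show ?thesis using K a(1) r(2) by blast
      qed (use v in simp)
    qed
    then have "vec.dim {v \<in> V i. \<forall>r\<in>I. Q r *v v = 0} \<le> vec.dim (\<Inter>j\<in>J. V j)"
      by (rule vec.dim_subset)
    moreover have "I \<subseteq> {r. a r \<in> Some ` J}" using False by (force simp: J_def)
    then have "card I \<le> sum c J" using a(2)[OF J(1)] card_mono by (metis finite)
    ultimately show ?thesis using c[OF J] by linarith
  qed
  \<comment> \<open>This specialisation replaces the generic row z_r by z_r Q_r with z_r still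
    generic, hence its values are again rational functions. It turns W \<open>v\<close> into the
    twisted image of \<open>v\<close>.\<close>
  define \<phi> :: "('a, 'k, 'n) mpoly \<Rightarrow> ('a, 'k, 'n) ratfun" where
    "\<phi> = eval_mpoly const_rf (\<lambda>r j. \<Sum>s\<in>UNIV. Zvar r s * const_rf (Q r $ s $ j))"
  interpret cr: unital_ring_hom "const_rf :: 'a \<Rightarrow> ('a, 'k, 'n) ratfun" by (rule unital_ring_hom_const_rf)
  interpret \<phi>: unital_ring_hom \<phi>
    unfolding \<phi>_def by (rule unital_ring_hom_eval_mpoly[OF unital_ring_hom_const_rf])
  interpret \<iota>: unital_ring_hom "to_fract :: ('a, 'k, 'n) mpoly \<Rightarrow> ('a, 'k, 'n) ratfun"
    by (rule unital_ring_hom_to_fract)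
  let ?t = "twisted_image (\<lambda>_. mat 1) :: 'a ^ 'n::{finite,linorder} \<Rightarrow> ('a, 'k, 'n) mpoly ^ 'k::{finite,linorder}"
  have \<phi>_t: "\<phi>.mapv (?t v) = \<iota>.mapv (twisted_image Q v)" for v
  proof -
    have "\<phi> (?t v $ r) = to_fract (twisted_image Q v $ r)" for r
    proof -
      have "\<phi> (?t v $ r) = (\<Sum>j\<in>UNIV. (\<Sum>s\<in>UNIV. Zvar r s * const_rf (Q r $ s $ j)) * const_rf (v $ j))"
        by (simp add: twisted_image_def \<phi>.sum \<phi>.mult)
          (simp add: \<phi>_def eval_mpoly_cpoly eval_mpoly_Zpoly unital_ring_hom_const_rf)
      also have "\<dots> = (\<Sum>s\<in>UNIV. Zvar r s * const_rf ((Q r *v v) $ s))"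
        by (simp add: matrix_vector_mult_def cr.sum cr.mult sum_distrib_left sum_distrib_right mult.assoc)
          (rule sum.swap)
      also have "\<dots> = to_fract (twisted_image Q v $ r)"
        by (simp add: twisted_image_def \<iota>.sum \<iota>.mult Zvar_eq const_rf_eq)
      finally show ?thesis .
    qed
    then show ?thesis by (simp add: vec_eq_iff)
  qed
  let ?D = "{r. a r \<in> Some ` L}"
  have "\<forall>r\<in>?D. \<exists>u d. d \<noteq> 0 \<and> \<phi>.mapv u = d *s axis r 1 \<and>
      (\<forall>y\<in>W_sub (V (the (a r))). (\<Sum>s\<in>UNIV. to_fract (u $ s) * y $ s) = 0)"
  proof
    fix r assume "r \<in> ?D"
    then obtain i where i: "i \<in> L" "a r = Some i" by auto
    obtain B where B: "B \<subseteq> V i" "vec.independent B" "V i \<subseteq> vec.span B"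
      using vec.basis_exists[of "V i"] by metis
    have span: "vec.span B = V i" using B(1,3) V[OF i(1)] vec.span_minimal by blast
    \<comment> \<open>The specialised images of a basis of \<open>V i\<close> are independent, and
      their coordinate \<open>r\<close> vanishes because row \<open>r\<close> has label
      \<open>i\<close>. These are the two requirements for an annihilator specialising to a multiple
      of \<open>axis r 1\<close>.\<close>
    note ind = twisted_image_independent[OF hall[OF i(1), folded span] B(2), folded \<phi>_t]
    have Qb: "\<phi> (?t b $ r) = 0" if "b \<in> B" for b
    proof -
      have "Q r *v b = 0" using that B(1) K i by (auto simp: Q_def)
      then have "twisted_image Q b $ r = 0" by (simp add: twisted_image_def cpoly_def)
      moreover have "\<phi> (?t b $ r) = to_fract (twisted_image Q b $ r)"
        using \<phi>_t[of b] by (metis \<phi>.mapv_nth \<iota>.mapv_nth)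
      ultimately show ?thesis by simp
    qed
    obtain u d where u: "d \<noteq> 0" "\<phi>.mapv u = d *s axis r 1"
      "\<And>b. b \<in> B \<Longrightarrow> (\<Sum>s\<in>UNIV. u $ s * ?t b $ s) = 0"
      by (rule annihilator_specialising_to_axis[OF \<phi>.unital_ring_hom_axioms ind Qb]) (assumption, rule that)
    let ?Z = "{y. (\<Sum>s\<in>UNIV. to_fract (u $ s) * y $ s) = 0}"
    have "vec.subspace ?Z"
      by (auto simp: vec.subspace_def distrib_left sum.distrib mult.left_commute[of "to_fract _"] sum_distrib_left[symmetric])
    moreover have "(\<lambda>b. Wmat *v embed_vec b) ` B \<subseteq> ?Z"
    proof clarify
      fix b assume "b \<in> B"
      then have "to_fract (\<Sum>s\<in>UNIV. u $ s * ?t b $ s) = 0" using u(3) by simp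
      then show "(\<Sum>s\<in>UNIV. to_fract (u $ s) * (Wmat *v embed_vec b) $ s) = 0"
        by (simp add: Wmat_embed_vec \<iota>.sum)
    qed
    ultimately have "W_sub (V i) \<subseteq> ?Z"
      unfolding span[symmetric] W_sub_span by (intro vec.span_minimal)
    with u(1,2) i(2) show "\<exists>u d. d \<noteq> 0 \<and> \<phi>.mapv u = d *s axis r 1 \<and>
      (\<forall>y\<in>W_sub (V (the (a r))). (\<Sum>s\<in>UNIV. to_fract (u $ s) * y $ s) = 0)"
      by (intro exI[of _ u] exI[of _ d]) auto
  qed
  then obtain u d where ud: "\<forall>r\<in>?D. d r \<noteq> 0 \<and> \<phi>.mapv (u r) = d r *s axis r 1 \<and>
      (\<forall>y\<in>W_sub (V (the (a r))). (\<Sum>s\<in>UNIV. to_fract (u r $ s) * y $ s) = 0)"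
    unfolding bchoice_iff by blast
  have "vec.dim (\<Inter>i\<in>L. W_sub (V i) :: (('a, 'k, 'n) ratfun ^ 'k::{finite,linorder}) set) + card ?D \<le> CARD('k)"
  proof (rule dim_le_of_specialised_annihilators[OF \<phi>.unital_ring_hom_axioms unital_ring_hom_to_fract inj_to_fract])
    show "d r \<noteq> 0" "\<phi>.mapv (u r) = d r *s axis r 1" if "r \<in> ?D" for r
      using ud that by blast+
    fix r y assume r: "r \<in> ?D" and y: "y \<in> (\<Inter>i\<in>L. W_sub (V i) :: (('a, 'k, 'n) ratfun ^ 'k::{finite,linorder}) set)"
    then have "y \<in> W_sub (V (the (a r)))" by auto
    with ud r show "(\<Sum>s\<in>UNIV. to_fract (u r $ s) * y $ s) = 0" by blast
  qed
  then show ?thesis using a(2)[of L] by simp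
qed

section \<open>The maximum over partitions\<close>

theorem mainTheorem6:
  fixes V :: "nat \<Rightarrow> ('a::{finite, field} ^ 'n::{finite, linorder}) set"
    and l :: nat
  assumes "CARD('k::{finite, linorder}) \<le> CARD('n)"
    and "l \<ge> 1"
    and "\<And>i. i < l \<Longrightarrow> vec.subspace (V i)"
    and "\<And>i. i < l \<Longrightarrow> vec.dim (V i) \<le> CARD('k)"
  shows "int (vec.dim (\<Inter>i<l. (W_sub (V i) :: (('a, 'k, 'n) ratfun, 'k) vec set))) =
    Max {(\<Sum>B\<in>P. int (vec.dim (\<Inter>j\<in>B. V j))) - (int (card P) - 1) * int CARD('k) | P.
         partition_on {..<l} P}"
proof -
  let ?L = "{..<l}"
  let ?k = "CARD('k)"
  let ?VJ = "\<lambda>J. \<Inter>j\<in>J. V j"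
  let ?W = "W_sub :: _ \<Rightarrow> (('a, 'k, 'n) ratfun, 'k) vec set"
  let ?f = "\<lambda>P. (\<Sum>B\<in>P. int (vec.dim (?VJ B))) - (int (card P) - 1) * int ?k"
  let ?S = "{?f P | P. partition_on ?L P}"
  have sub: "vec.subspace (?VJ J)" if "J \<subseteq> ?L" for J
    using that assms(3) by (intro vec.subspace_Inter) auto
  have dim: "vec.dim (?VJ J) \<le> ?k" if "J \<subseteq> ?L" "J \<noteq> {}" for J
  proof -
    from that obtain j where "j \<in> J" "j < l" by auto
    then have "vec.dim (?VJ J) \<le> vec.dim (V j)" by (intro vec.dim_subset) auto
    with assms(4)[OF \<open>j < l\<close>] show ?thesis by simp
  qed
  \<comment> \<open>For nonempty \<open>J\<close> the subtraction does not truncate, by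
    \<open>dim\<close>. The empty intersection of index sets is excluded below because the whole
    space may have dimension above k.\<close>
  define g where "g J = ?k - vec.dim (?VJ J)" for J
  have "g (J \<union> J') + g (J \<inter> J') \<le> g J + g J'"
    if J: "J \<subseteq> ?L" "J' \<subseteq> ?L" "J \<inter> J' \<noteq> {}" for J J'
  proof -
    have "vec.dim {x + y |x y. x \<in> ?VJ J \<and> y \<in> ?VJ J'} + vec.dim (?VJ J \<inter> ?VJ J')
        = vec.dim (?VJ J) + vec.dim (?VJ J')"
      using sub J by (intro vec.dim_sums_Int) auto
    moreover have "?VJ J \<inter> ?VJ J' = ?VJ (J \<union> J')" by auto
    moreover have "vec.dim {x + y |x y. x \<in> ?VJ J \<and> y \<in> ?VJ J'} \<le> vec.dim (?VJ (J \<inter> J'))"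
    proof (rule vec.dim_subset, clarify)
      fix x y j assume "x \<in> ?VJ J" "y \<in> ?VJ J'" "j \<in> J" "j \<in> J'"
      then show "x + y \<in> V j" using assms(3)[of j] J(1) by (auto intro: vec.subspace_add)
    qed
    moreover have "vec.dim (?VJ J) \<le> ?k" "vec.dim (?VJ J') \<le> ?k" "vec.dim (?VJ (J \<inter> J')) \<le> ?k" "vec.dim (?VJ (J \<union> J')) \<le> ?k"
      using J by (auto intro!: dim)
    ultimately show ?thesis unfolding g_def by simp
  qed
  then obtain c P where P: "partition_on ?L P"
    and c: "\<And>J. J \<subseteq> ?L \<Longrightarrow> J \<noteq> {} \<Longrightarrow> sum c J \<le> g J" "\<And>B. B \<in> P \<Longrightarrow> sum c B = g B"
    using intersecting_submodular_tight_partition[of ?L g] by (metis finite_lessThan)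
  have L_ne: "?L \<noteq> {}" using assms(2) by (simp add: lessThan_empty_iff)
  have part: "finite P'" "P' \<noteq> {}" "\<And>B. B \<in> P' \<Longrightarrow> B \<subseteq> ?L" "\<And>B. B \<in> P' \<Longrightarrow> B \<noteq> {}" "\<Union>P' = ?L"
    if "partition_on ?L P'" for P'
  proof -
    show "P' \<noteq> {}" using that L_ne by (metis Union_empty partition_on_def)
  qed (use that finite_elements[OF _ that] in \<open>auto simp: partition_on_def\<close>)
  have "vec.dim (\<Inter>i\<in>?L. ?W (V i)) + sum c ?L \<le> ?k"
  proof (rule dim_INT_W_sub_le)
    show "?L \<noteq> {}" by (rule L_ne)
    show "vec.dim (?VJ J) + sum c J \<le> ?k" if "J \<subseteq> ?L" "J \<noteq> {}" for J
      using c(1)[OF that] dim[OF that] by (simp add: g_def)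
  qed (use assms(3) in auto)
  then have "int (vec.dim (\<Inter>i\<in>?L. ?W (V i)) + sum c ?L) \<le> int ?k"
    by (simp only: of_nat_le_iff)
  moreover have sum_eq: "sum c ?L = (\<Sum>B\<in>P. sum c B)"
    using P part[OF P] by (metis partition_on_def sum.Union_disjoint_sets finite_lessThan finite_subset comp_def)
  moreover have int_sum_eq: "int (\<Sum>B\<in>P. sum c B) = (\<Sum>B\<in>P. int ?k - int (vec.dim (?VJ B)))"
  proof (subst of_nat_sum, rule sum.cong)
    fix B assume B: "B \<in> P"
    show "int (sum c B) = int ?k - int (vec.dim (?VJ B))"
      unfolding c(2)[OF B] g_def using dim[OF part(3)[OF P B] part(4)[OF P B]] by (simp add: of_nat_diff)
  qed simp
  ultimately have "int (vec.dim (\<Inter>i\<in>?L. ?W (V i))) + (\<Sum>B\<in>P. int ?k - int (vec.dim (?VJ B))) \<le> int ?k"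
    by (simp only: of_nat_add sum_eq int_sum_eq)
  \<comment> \<open>Tightness of the blocks turns the total of \<open>c\<close> into the sum of
    their codimensions, so the bound is exactly the value at \<open>P\<close>.\<close>
  then have upper: "int (vec.dim (\<Inter>i\<in>?L. ?W (V i))) \<le> ?f P"
    by (simp add: sum_subtractf algebra_simps)
  have lower: "?f P' \<le> int (vec.dim (\<Inter>i\<in>?L. ?W (V i)))" if P': "partition_on ?L P'" for P'
  proof -
    note pt = part[OF P']
    \<comment> \<open>Passing to W preserves each block's dimension, since that dimension is at most
      k. Codimension subadditivity can then be used inside the k-dimensional space.\<close>
    have "?f P' = (\<Sum>B\<in>P'. int (vec.dim (?W (?VJ B)))) - (int (card P') - 1) * int ?k"
      using pt sub dim dim_W_sub by (metis (no_types, lifting) sum.cong)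
    also have "\<dots> \<le> int (vec.dim (\<Inter>B\<in>P'. ?W (?VJ B)))"
      using pt(1,2) by (rule dim_INT_ge) (simp add: W_sub_def)
    also have "vec.dim (\<Inter>B\<in>P'. ?W (?VJ B)) \<le> vec.dim (\<Inter>i\<in>?L. ?W (V i))"
    proof (rule vec.dim_subset, rule INT_greatest)
      fix i assume "i \<in> ?L"
      then obtain B where "B \<in> P'" "i \<in> B" using pt(5) by auto
      then show "(\<Inter>B\<in>P'. ?W (?VJ B)) \<subseteq> ?W (V i)"
        using W_sub_mono[of "?VJ B" "V i"] by blast
    qed
    finally show ?thesis by simp
  qed
  have fin: "finite ?S"
  proof -
    have "{P. partition_on ?L P} \<subseteq> Pow (Pow ?L)" by (auto simp: partition_on_def)
    then have "finite {P. partition_on ?L P}" by (rule finite_subset) simp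
    then show ?thesis by simp
  qed
  show ?thesis
  proof (rule antisym)
    \<comment> \<open>The tight partition \<open>P\<close> is one of the competitors, so its value
      bounds the dimension by the maximum.\<close>
    have "?f P \<le> Max ?S" using fin P by (intro Max_ge) auto
    with upper show "int (vec.dim (\<Inter>i\<in>?L. ?W (V i))) \<le> Max ?S" by linarith
    show "Max ?S \<le> int (vec.dim (\<Inter>i\<in>?L. ?W (V i)))"
      using fin P lower by (subst Max_le_iff) auto
  qed
qed

end
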